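(* Let $Y_1,Y_2,\dots$ be i.i.d. real random variables with mean $0$ and (finite) variance $\sigma^2>0$, and let $S_n=Y_1+\dots+Y_n$. Then $$\sum_{n=1}^\infty\frac{S_n^2}{n^2}=\infty\quad\text{almost surely.}$$ *)

theory Defs
  imports "HOL-Probability.Probability"
begin

end

theory Submission
  imports Defs
begin

text \<open>
  By the Kolmogorov 0-1 law the series either converges almost surely or diverges almost surely.
  If it converged, its blocks over \<open>{K j..<K j + j}\<close> would tend to \<open>0\<close> in probability as
  \<open>j \<longlonglongrightarrow> \<infinity>\<close>. But with \<open>m = K j\<close>, the central limit theorem keeps the probability of
  \<open>S\<^sub>m\<^sup>2 \<ge> \<sigma>\<^sup>2 m\<close> above some \<open>p > 0\<close> that does not depend on \<open>K\<close>. By Markov's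
  inequality the fluctuations of \<open>S\<^sub>n - S\<^sub>m\<close> within the block spoil this with probability
  only \<open>O(1 / K)\<close>, so for large \<open>K\<close> the block is at least a constant multiple of
  \<open>\<sigma>\<^sup>2 / K\<close> with probability at least \<open>p / 2\<close>.
\<close>

section \<open>Deterministic inequalities for partial sums\<close>

text \<open>The bound holds term by term: for n in the block, m <= n <= (K+1) j, and half of (s m)^2
  is at most (s n)^2 + (s n - s m)^2. The left side is j copies of the resulting lower bound. Thus a
  large \<open>s m\<close> forces either a large block or a large fluctuation.\<close>

lemma sum_squares_le_block:
  fixes s :: "nat \<Rightarrow> real"
  assumes "K > 0" "j > 0"
  defines "m \<equiv> K * j"
  shows "(s m)\<^sup>2 / (2 * (real K + 1)\<^sup>2 * real j)
      \<le> (\<Sum>n=m..<m + j. (s n / real n)\<^sup>2) + (\<Sum>n=m..<m + j. (s n - s m)\<^sup>2) / (real m)\<^sup>2"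
proof -
  have m: "m > 0" using assms by (simp add: m_def)
  have "(s m)\<^sup>2 / (2 * (real K + 1)\<^sup>2 * real j)
      = (\<Sum>n=m..<m + j. (s m)\<^sup>2 / 2 / ((real K + 1) * real j)\<^sup>2)"
  proof -
    have "a / (2 * k\<^sup>2 * r) = r * (a / 2 / (k * r)\<^sup>2)" if "r > 0" for a k r :: real
      using that by (cases "k = 0") (simp_all add: power2_eq_square field_simps)
    then show ?thesis using \<open>j > 0\<close> by simp
  qed
  also have "\<dots> \<le> (\<Sum>n=m..<m + j. (s n / real n)\<^sup>2 + (s n - s m)\<^sup>2 / (real m)\<^sup>2)"
  proof (rule sum_mono)
    fix n assume n: "n \<in> {m..<m + j}"
    have "real n \<le> real (m + j)" using n by (intro of_nat_mono) auto
    then have up: "real n \<le> (real K + 1) * real j" by (simp add: m_def algebra_simps)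
    have lo: "0 < real m" "real m \<le> real n" using n m by auto
    \<comment> \<open>Half of this square is exactly the difference of the two sides of
      \<open>sq\<close>.\<close>
    have "(2 * s n - s m)\<^sup>2 \<ge> 0" by simp
    then have sq: "(s m)\<^sup>2 / 2 \<le> (s n)\<^sup>2 + (s n - s m)\<^sup>2"
      by (simp add: power2_eq_square algebra_simps)
    have "(s m)\<^sup>2 / 2 / ((real K + 1) * real j)\<^sup>2 \<le> (s m)\<^sup>2 / 2 / (real n)\<^sup>2"
      using up lo \<open>j > 0\<close> by (intro divide_left_mono power_mono mult_pos_pos zero_less_power) auto
    also have "\<dots> \<le> ((s n)\<^sup>2 + (s n - s m)\<^sup>2) / (real n)\<^sup>2"
      using sq by (rule divide_right_mono) simp
    also have "\<dots> = (s n / real n)\<^sup>2 + (s n - s m)\<^sup>2 / (real n)\<^sup>2"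
      by (simp add: add_divide_distrib power_divide)
    also have "(s n - s m)\<^sup>2 / (real n)\<^sup>2 \<le> (s n - s m)\<^sup>2 / (real m)\<^sup>2"
      using lo by (intro divide_left_mono power_mono mult_pos_pos zero_less_power) auto
    finally show "(s m)\<^sup>2 / 2 / ((real K + 1) * real j)\<^sup>2
        \<le> (s n / real n)\<^sup>2 + (s n - s m)\<^sup>2 / (real m)\<^sup>2" by simp
  qed
  also have "\<dots> = (\<Sum>n=m..<m + j. (s n / real n)\<^sup>2) + (\<Sum>n=m..<m + j. (s n - s m)\<^sup>2) / (real m)\<^sup>2"
    by (simp add: sum.distrib sum_divide_distrib)
  finally show ?thesis .
qed

text \<open>Comparison via (t + c)^2 <= 2 t^2 + 2 c^2 and the convergence of the sum of 1/n^2. At n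
  = 0 every quotient is 0, so the comparison holds there too.\<close>

lemma summable_shifted_squares:
  fixes t :: "nat \<Rightarrow> real"
  assumes "summable (\<lambda>n. (t n / real n)\<^sup>2)"
  shows "summable (\<lambda>n. ((t n + c) / real n)\<^sup>2)"
proof (rule summable_comparison_test')
  have "summable (\<lambda>n. 1 / (real n)\<^sup>2)"
    using inverse_power_summable[of 2, where 'a=real] by (simp add: inverse_eq_divide)
  then show "summable (\<lambda>n. 2 * (t n / real n)\<^sup>2 + 2 * c\<^sup>2 * (1 / (real n)\<^sup>2))"
    using assms by (intro summable_add summable_mult)
  fix n :: nat
  have "(t n - c)\<^sup>2 \<ge> 0" by simp
  then have "(t n + c)\<^sup>2 \<le> 2 * (t n)\<^sup>2 + 2 * c\<^sup>2"
    by (simp add: power2_eq_square algebra_simps)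
  then have "((t n + c) / real n)\<^sup>2 \<le> (2 * (t n)\<^sup>2 + 2 * c\<^sup>2) / (real n)\<^sup>2"
    unfolding power_divide by (rule divide_right_mono) simp
  also have "\<dots> = 2 * (t n / real n)\<^sup>2 + 2 * c\<^sup>2 * (1 / (real n)\<^sup>2)"
    by (simp add: power_divide add_divide_distrib)
  finally show "norm (((t n + c) / real n)\<^sup>2) \<le> 2 * (t n / real n)\<^sup>2 + 2 * c\<^sup>2 * (1 / (real n)\<^sup>2)"
    by simp
qed

text \<open>From index k on, dropping the first k summands shifts the partial sums by a constant;
  shifting by that constant and back gives both directions. This is what makes summability a tail
  property.\<close>

lemma summable_squares_drop_initial:
  fixes x :: "nat \<Rightarrow> real"
  shows "summable (\<lambda>n. ((\<Sum>i<n. x i) / real n)\<^sup>2) \<longleftrightarrow> summable (\<lambda>n. ((\<Sum>i=k..<n. x i) / real n)\<^sup>2)"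
proof -
  have split: "(\<Sum>i<n. x i) = (\<Sum>i=k..<n. x i) + (\<Sum>i<k. x i)" if "n \<ge> k" for n
    using sum.atLeastLessThan_concat[of 0 k n x] that by (simp add: atLeast0LessThan)
  have "summable (\<lambda>n. ((\<Sum>i<n. x i) / real n)\<^sup>2)
      \<longleftrightarrow> summable (\<lambda>n. (((\<Sum>i=k..<n. x i) + (\<Sum>i<k. x i)) / real n)\<^sup>2)"
    by (intro summable_cong eventually_sequentiallyI[of k]) (subst split, simp_all)
  also have "\<dots> \<longleftrightarrow> summable (\<lambda>n. ((\<Sum>i=k..<n. x i) / real n)\<^sup>2)"
    using summable_shifted_squares[of "\<lambda>n. \<Sum>i=k..<n. x i" "\<Sum>i<k. x i"]
      summable_shifted_squares[of "\<lambda>n. (\<Sum>i=k..<n. x i) + (\<Sum>i<k. x i)" "- (\<Sum>i<k. x i)"]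
    by auto
  finally show ?thesis .
qed

section \<open>The standard normal distribution\<close>

text \<open>The density is strictly positive, so a half-line of measure 0 would be Lebesgue null,
  although it contains an interval of length 1.\<close>

lemma std_normal_distribution_atMost_pos: "measure std_normal_distribution {..x} > 0"
proof -
  interpret real_distribution std_normal_distribution by (rule real_dist_normal_dist)
  have "{..x} \<notin> null_sets std_normal_distribution"
  proof
    assume "{..x} \<in> null_sets std_normal_distribution"
    then have "AE y in lborel. y \<in> {..x} \<longrightarrow> ennreal (std_normal_density y) = 0"
      by (subst (asm) null_sets_density_iff) auto
    then have "AE y in lborel. y \<notin> {..x}"
      by eventually_elim (auto simp: less_imp_neq[OF normal_density_pos, symmetric])
    then have "{..x} \<in> null_sets lborel"
      by (subst AE_iff_null_sets) auto
    then have "{x - 1..x} \<in> null_sets lborel"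
      by (rule null_sets_subset) auto
    then show False by (auto simp: null_sets_def)
  qed
  then have "emeasure std_normal_distribution {..x} \<noteq> 0" by (auto simp: null_sets_def)
  then show ?thesis by (simp add: emeasure_eq_measure zero_less_measure_iff)
qed

text \<open>Absolute continuity excludes atoms; this makes the limiting cdf continuous at the point
  where weak convergence is evaluated.\<close>

lemma std_normal_distribution_singleton: "measure std_normal_distribution {x} = 0"
proof -
  have "{x} \<in> null_sets lborel" by (simp add: null_sets_def)
  then have "{x} \<in> null_sets std_normal_distribution"
    using absolutely_continuousI_density[of "\<lambda>x. ennreal (std_normal_density x)" lborel]
    unfolding absolutely_continuous_def by auto
  then show ?thesis by (simp add: null_sets_def measure_def)
qed

section \<open>Independence and second moments\<close>

context prob_space
begin

text \<open>An injective relabelling turns a finite choice of events over \<open>J\<close> into one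
  over the image of \<open>J\<close>, so the product formula carries over. It serves to move the
  index set \<open>{1..}\<close> to all of the naturals.\<close>

lemma indep_vars_reindex:
  assumes indep: "indep_vars M' X (f ` I)" and inj: "inj_on f I"
  shows "indep_vars (M' \<circ> f) (X \<circ> f) I"
proof -
  let ?F = "\<lambda>i. {X i -` A \<inter> space M |A. A \<in> sets (M' i)}"
  have "indep_sets (?F \<circ> f) I"
    unfolding indep_sets_def
  proof (intro conjI ballI allI impI)
    show "(?F \<circ> f) i \<subseteq> events" if "i \<in> I" for i
      using indep that unfolding indep_vars_def2 indep_sets_def by auto
    fix J A assume J: "J \<subseteq> I" "J \<noteq> {}" "finite J" and A: "A \<in> Pi J (?F \<circ> f)"
    define B where "B = A \<circ> the_inv_into I f"
    have B: "B (f j) = A j" if "j \<in> J" for j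
      using that J inj by (auto simp: B_def the_inv_into_f_f)
    have "f ` J \<subseteq> f ` I" "f ` J \<noteq> {}" "finite (f ` J)" using J by auto
    moreover have "B \<in> Pi (f ` J) ?F" using A B by auto
    ultimately have "prob (\<Inter>j\<in>f ` J. B j) = (\<Prod>j\<in>f ` J. prob (B j))"
      using indep unfolding indep_vars_def2 indep_sets_def by blast
    then show "prob (\<Inter>j\<in>J. A j) = (\<Prod>j\<in>J. prob (A j))"
      using B inj J by (simp add: prod.reindex inj_on_subset)
  qed
  then show ?thesis
    using indep unfolding indep_vars_def2 by (simp add: comp_def)
qed

lemma integrable_mult_indep_vars:
  fixes X :: "'i \<Rightarrow> 'a \<Rightarrow> real"
  assumes "indep_vars (\<lambda>_. borel) X I" "\<And>i. i \<in> I \<Longrightarrow> integrable M (X i)"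
    and "\<And>i. i \<in> I \<Longrightarrow> integrable M (\<lambda>\<omega>. (X i \<omega>)\<^sup>2)" "i \<in> I" "j \<in> I"
  shows "integrable M (\<lambda>\<omega>. X i \<omega> * X j \<omega>)"
proof (cases "i = j")
  case False
  have "integrable M (\<lambda>\<omega>. \<Prod>k\<in>{i, j}. X k \<omega>)"
    by (rule indep_vars_integrable) (use assms in \<open>auto intro: indep_vars_subset\<close>)
  then show ?thesis using False by simp
qed (use assms in \<open>auto simp: power2_eq_square\<close>)

text \<open>Independent centred variables are orthogonal, so only the diagonal terms of the expanded
  square survive.\<close>

lemma expectation_square_sum_indep:
  fixes X :: "'i \<Rightarrow> 'a \<Rightarrow> real"
  assumes indep: "indep_vars (\<lambda>_. borel) X I" and int: "\<And>i. i \<in> I \<Longrightarrow> integrable M (X i)"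
    and sq: "\<And>i. i \<in> I \<Longrightarrow> integrable M (\<lambda>\<omega>. (X i \<omega>)\<^sup>2)"
    and mean: "\<And>i. i \<in> I \<Longrightarrow> expectation (X i) = 0" and fin: "finite I"
  shows "integrable M (\<lambda>\<omega>. (\<Sum>i\<in>I. X i \<omega>)\<^sup>2)"
    and "expectation (\<lambda>\<omega>. (\<Sum>i\<in>I. X i \<omega>)\<^sup>2) = (\<Sum>i\<in>I. expectation (\<lambda>\<omega>. (X i \<omega>)\<^sup>2))"
proof -
  have expand: "(\<lambda>\<omega>. (\<Sum>i\<in>I. X i \<omega>)\<^sup>2) = (\<lambda>\<omega>. \<Sum>i\<in>I. \<Sum>j\<in>I. X i \<omega> * X j \<omega>)"
    by (simp add: power2_eq_square sum_product)
  note prod_int = integrable_mult_indep_vars[OF indep int sq]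
  show "integrable M (\<lambda>\<omega>. (\<Sum>i\<in>I. X i \<omega>)\<^sup>2)"
    unfolding expand by (intro Bochner_Integration.integrable_sum prod_int)
  have orth: "expectation (\<lambda>\<omega>. X i \<omega> * X j \<omega>) = (if j = i then expectation (\<lambda>\<omega>. (X i \<omega>)\<^sup>2) else 0)"
    if "i \<in> I" "j \<in> I" for i j
  proof (cases "j = i")
    case False
    have "expectation (\<lambda>\<omega>. \<Prod>k\<in>{i, j}. X k \<omega>) = (\<Prod>k\<in>{i, j}. expectation (X k))"
      by (rule indep_vars_lebesgue_integral) (use indep int that in \<open>auto intro: indep_vars_subset\<close>)
    then show ?thesis using False mean that by simp
  qed (simp add: power2_eq_square)
  have "expectation (\<lambda>\<omega>. (\<Sum>i\<in>I. X i \<omega>)\<^sup>2) = (\<Sum>i\<in>I. \<Sum>j\<in>I. expectation (\<lambda>\<omega>. X i \<omega> * X j \<omega>))"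
    unfolding expand
    by (simp add: Bochner_Integration.integral_sum Bochner_Integration.integrable_sum prod_int)
  also have "\<dots> = (\<Sum>i\<in>I. expectation (\<lambda>\<omega>. (X i \<omega>)\<^sup>2))"
    using fin by (simp add: orth cong: sum.cong)
  finally show "expectation (\<lambda>\<omega>. (\<Sum>i\<in>I. X i \<omega>)\<^sup>2) = (\<Sum>i\<in>I. expectation (\<lambda>\<omega>. (X i \<omega>)\<^sup>2))" .
qed

section \<open>Zero-one law for the series\<close>

text \<open>For every k the event of summability can be expressed through the variables of index at
  least k, so it is a tail event and has probability 0 or 1.\<close>

lemma summable_squares_zero_one:
  fixes X :: "nat \<Rightarrow> 'a \<Rightarrow> real"
  assumes indep: "indep_vars (\<lambda>_. borel) X UNIV"
  shows "(AE \<omega> in M. summable (\<lambda>n. ((\<Sum>i<n. X i \<omega>) / real n)\<^sup>2))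
       \<or> (AE \<omega> in M. \<not> summable (\<lambda>n. ((\<Sum>i<n. X i \<omega>) / real n)\<^sup>2))"
proof -
  define F where "F i = sigma_sets (space M) {X i -` A \<inter> space M | A. A \<in> sets borel}" for i
  define E where "E = {\<omega> \<in> space M. summable (\<lambda>n. ((\<Sum>i<n. X i \<omega>) / real n)\<^sup>2)}"
  have rv: "\<And>i. random_variable borel (X i)" and ind: "indep_sets F UNIV"
    using indep unfolding indep_vars_def F_def by auto
  have sa: "sigma_algebra (space M) (F i)" for i
    unfolding F_def by (rule sigma_algebra_sigma_sets) auto
  have tail: "E \<in> tail_events F"
    unfolding tail_events_def
  proof
    fix k
    let ?G = "\<Union> (F ` {k..})"
    \<comment> \<open>\<open>N\<close> carries the sigma-algebra generated by the \<open>X i\<close>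
      with i >= k; measurability in \<open>N\<close> replaces an explicit construction from
      generators.\<close>
    define N where "N = sigma (space M) ?G"
    have G: "?G \<subseteq> Pow (space M)"
      using ind sets.sets_into_space unfolding indep_sets_def by blast
    have X: "X i \<in> borel_measurable N" if "i \<in> {k..}" for i
    proof (rule measurableI)
      fix A :: "real set" assume "A \<in> sets borel"
      then have "X i -` A \<inter> space M \<in> F i" unfolding F_def by blast
      then have "X i -` A \<inter> space M \<in> ?G" using that by blast
      then show "X i -` A \<inter> space N \<in> sets N" using G unfolding N_def by simp
    qed simp
    have [measurable]: "(\<lambda>\<omega>. \<Sum>i=k..<n. X i \<omega>) \<in> borel_measurable N" for n
      by (rule borel_measurable_sum) (simp add: X)
    have "{\<omega> \<in> space N. summable (\<lambda>n. ((\<Sum>i=k..<n. X i \<omega>) / real n)\<^sup>2)} \<in> sets N"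
      \<comment> \<open>The Cauchy criterion describes convergence by countably many conditions,
        hence by a measurable set.\<close>
      unfolding summable_iff_convergent Cauchy_convergent_iff[symmetric]
      by (intro sets_Collect_Cauchy borel_measurable_sum) measurable
    then show "E \<in> sigma_sets (space M) ?G"
      unfolding E_def summable_squares_drop_initial[of _ k] using G by (simp add: N_def)
  qed
  have "E \<in> events"
    using tail_events_sets[of F] tail ind unfolding indep_sets_def by auto
  then show ?thesis
    using kolmogorov_0_1_law[OF sa ind tail]
      prob_Collect_eq_0[of "\<lambda>\<omega>. summable (\<lambda>n. ((\<Sum>i<n. X i \<omega>) / real n)\<^sup>2)"]
      prob_Collect_eq_1[of "\<lambda>\<omega>. summable (\<lambda>n. ((\<Sum>i<n. X i \<omega>) / real n)\<^sup>2)"]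
    unfolding E_def by blast
qed

section \<open>Probability bounds for partial sums and blocks\<close>

text \<open>Dominated convergence, with bound 1, for the indicators of the events. The one-sided
  form suffices for blocks of squares, which are nonnegative.\<close>

lemma prob_tendsto_0_if_AE_tendsto_0:
  fixes f :: "nat \<Rightarrow> 'a \<Rightarrow> real"
  assumes [measurable]: "\<And>n. f n \<in> borel_measurable M"
    and lim: "AE \<omega> in M. (\<lambda>n. f n \<omega>) \<longlonglongrightarrow> 0" and "\<delta> > 0"
  shows "(\<lambda>n. prob {\<omega> \<in> space M. f n \<omega> \<ge> \<delta>}) \<longlonglongrightarrow> 0"
proof -
  have "(\<lambda>n. expectation (indicator {\<omega> \<in> space M. f n \<omega> \<ge> \<delta>})) \<longlonglongrightarrow> expectation (\<lambda>_. 0 :: real)"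
  proof (rule integral_dominated_convergence)
    show "AE \<omega> in M. (\<lambda>n. indicator {\<omega> \<in> space M. f n \<omega> \<ge> \<delta>} \<omega> :: real) \<longlonglongrightarrow> 0"
      using lim
    proof eventually_elim
      fix \<omega> assume "(\<lambda>n. f n \<omega>) \<longlonglongrightarrow> 0"
      then have "\<forall>\<^sub>F n in sequentially. f n \<omega> < \<delta>"
        using \<open>\<delta> > 0\<close> by (rule order_tendstoD)
      then show "(\<lambda>n. indicator {\<omega> \<in> space M. f n \<omega> \<ge> \<delta>} \<omega> :: real) \<longlonglongrightarrow> 0"
        by (intro tendsto_eventually) (auto elim: eventually_mono)
    qed
    show "integrable M (\<lambda>_. 1 :: real)" by simp
  qed (auto simp: indicator_def)
  then show ?thesis by (simp add: Int_absorb2 cong: Collect_cong)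
qed

text \<open>If the normalized sum is at most -1, its square is at least 1. By the central limit
  theorem the probability of this tends to a positive limit, so half of the limit is eventually a
  lower bound.\<close>

lemma clt_lower_bound:
  fixes X :: "nat \<Rightarrow> 'a \<Rightarrow> real" and \<sigma> :: real
  assumes "indep_vars (\<lambda>_. borel) X UNIV" "\<And>n. expectation (X n) = 0" and \<sigma>: "\<sigma> > 0"
    and "\<And>n. integrable M (\<lambda>\<omega>. (X n \<omega>)\<^sup>2)" "\<And>n. variance (X n) = \<sigma>\<^sup>2"
    and "\<And>n. distr M borel (X n) = \<mu>"
  obtains p where "p > 0"
    "\<forall>\<^sub>F n in sequentially. p \<le> prob {\<omega> \<in> space M. \<sigma>\<^sup>2 * real n \<le> (\<Sum>i<n. X i \<omega>)\<^sup>2}"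
proof -
  let ?Z = "\<lambda>n \<omega>. (\<Sum>i<n. X i \<omega>) / sqrt (real n * \<sigma>\<^sup>2)"
  have [measurable]: "random_variable borel (X n)" for n
    using assms(1) unfolding indep_vars_def2 by simp
  interpret N: real_distribution std_normal_distribution by (rule real_dist_normal_dist)
  define q where "q = measure std_normal_distribution {..-1}"
  have q: "q > 0" unfolding q_def by (rule std_normal_distribution_atMost_pos)
  have "weak_conv_m (\<lambda>n. distr M borel (?Z n)) std_normal_distribution"
    by (rule central_limit_theorem_zero_mean[OF assms])
  then have "(\<lambda>n. cdf (distr M borel (?Z n)) (-1)) \<longlonglongrightarrow> cdf std_normal_distribution (-1)"
    unfolding weak_conv_m_def weak_conv_def
    \<comment> \<open>Weak convergence yields convergence of cdfs only at continuity points of the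
      limit; -1 is one because it carries no mass.\<close>
    using N.isCont_cdf[of "-1"] by (simp add: std_normal_distribution_singleton)
  then have "\<forall>\<^sub>F n in sequentially. q / 2 < cdf (distr M borel (?Z n)) (-1)"
    using q by (intro order_tendstoD(1)) (auto simp: cdf_def2 q_def)
  then have "\<forall>\<^sub>F n in sequentially. q / 2 \<le> prob {\<omega> \<in> space M. \<sigma>\<^sup>2 * real n \<le> (\<Sum>i<n. X i \<omega>)\<^sup>2}"
    using eventually_gt_at_top[of 0]
  proof eventually_elim
    fix n :: nat assume "q / 2 < cdf (distr M borel (?Z n)) (-1)" and n: "0 < n"
    then have "q / 2 \<le> prob {\<omega> \<in> space M. ?Z n \<omega> \<le> -1}"
      by (simp add: cdf_def2 measure_distr vimage_def Int_def conj_commute)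
    also have "\<dots> \<le> prob {\<omega> \<in> space M. \<sigma>\<^sup>2 * real n \<le> (\<Sum>i<n. X i \<omega>)\<^sup>2}"
    proof (rule finite_measure_mono)
      have "\<sigma>\<^sup>2 * real n \<le> s\<^sup>2" if "s / sqrt (real n * \<sigma>\<^sup>2) \<le> -1" for s
      proof -
        have "sqrt (real n * \<sigma>\<^sup>2) > 0" using n \<sigma> by simp
        then have "sqrt (real n * \<sigma>\<^sup>2) \<le> - s" using that by (simp add: divide_le_eq)
        then have "(sqrt (real n * \<sigma>\<^sup>2))\<^sup>2 \<le> (- s)\<^sup>2" by (intro power_mono) auto
        then show ?thesis by (simp add: mult.commute)
      qed
      then show "{\<omega> \<in> space M. ?Z n \<omega> \<le> -1} \<subseteq> {\<omega> \<in> space M. \<sigma>\<^sup>2 * real n \<le> (\<Sum>i<n. X i \<omega>)\<^sup>2}"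
        by blast
    qed measurable
    finally show "q / 2 \<le> prob {\<omega> \<in> space M. \<sigma>\<^sup>2 * real n \<le> (\<Sum>i<n. X i \<omega>)\<^sup>2}" .
  qed
  then show ?thesis using q by (intro that[of "q / 2"]) auto
qed

text \<open>Markov's inequality: each of the j squared increments has expectation (n - m)
  \<sigma>^2, at most j \<sigma>^2.\<close>

lemma prob_block_fluctuation:
  fixes X :: "nat \<Rightarrow> 'a \<Rightarrow> real" and \<sigma> :: real
  assumes indep: "indep_vars (\<lambda>_. borel) X UNIV" and int: "\<And>n. integrable M (X n)"
    and mean: "\<And>n. expectation (X n) = 0" and sq: "\<And>n. integrable M (\<lambda>\<omega>. (X n \<omega>)\<^sup>2)"
    and var: "\<And>n. variance (X n) = \<sigma>\<^sup>2" and "c > 0"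
  shows "prob {\<omega> \<in> space M. c \<le> (\<Sum>n=m..<m + j. ((\<Sum>i<n. X i \<omega>) - (\<Sum>i<m. X i \<omega>))\<^sup>2)}
       \<le> (real j)\<^sup>2 * \<sigma>\<^sup>2 / c"
proof -
  let ?W = "\<lambda>\<omega>. \<Sum>n=m..<m + j. (\<Sum>i=m..<n. X i \<omega>)\<^sup>2"
  have diff: "(\<Sum>i<n. X i \<omega>) - (\<Sum>i<m. X i \<omega>) = (\<Sum>i=m..<n. X i \<omega>)" if "n \<ge> m" for n \<omega>
    using sum.atLeastLessThan_concat[of 0 m n "\<lambda>i. X i \<omega>"] that by (simp add: atLeast0LessThan)
  have I: "integrable M (\<lambda>\<omega>. (\<Sum>i=m..<n. X i \<omega>)\<^sup>2)"
    "expectation (\<lambda>\<omega>. (\<Sum>i=m..<n. X i \<omega>)\<^sup>2) = real (n - m) * \<sigma>\<^sup>2" for n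
    using expectation_square_sum_indep[of X "{m..<n}"] indep_vars_subset[OF indep] int mean sq var
    by simp_all
  have "prob {\<omega> \<in> space M. c \<le> ?W \<omega>} \<le> expectation ?W / c"
    by (rule integral_Markov_inequality_measure[where A="space M"])
      (use I \<open>c > 0\<close> in \<open>auto intro!: Bochner_Integration.integrable_sum sum_nonneg\<close>)
  also have "expectation ?W = (\<Sum>n=m..<m + j. real (n - m) * \<sigma>\<^sup>2)"
    by (subst Bochner_Integration.integral_sum) (use I in auto)
  also have "\<dots> \<le> (\<Sum>n=m..<m + j. real j * \<sigma>\<^sup>2)"
    by (intro sum_mono mult_right_mono) auto
  also have "\<dots> = (real j)\<^sup>2 * \<sigma>\<^sup>2" by (simp add: power2_eq_square)
  finally have "prob {\<omega> \<in> space M. c \<le> ?W \<omega>} \<le> (real j)\<^sup>2 * \<sigma>\<^sup>2 / c"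
    using \<open>c > 0\<close> by (simp add: divide_right_mono)
  moreover have "(\<Sum>n=m..<m + j. ((\<Sum>i<n. X i \<omega>) - (\<Sum>i<m. X i \<omega>))\<^sup>2) = ?W \<omega>" for \<omega>
    by (intro sum.cong) (simp_all add: diff)
  ultimately show ?thesis by simp
qed

section \<open>Contradiction from almost sure summability\<close>

lemma AE_not_summable_squares:
  fixes X :: "nat \<Rightarrow> 'a \<Rightarrow> real" and \<sigma> :: real
  assumes indep: "indep_vars (\<lambda>_. borel) X UNIV" and int: "\<And>n. integrable M (X n)"
    and mean: "\<And>n. expectation (X n) = 0" and sq: "\<And>n. integrable M (\<lambda>\<omega>. (X n \<omega>)\<^sup>2)"
    and var: "\<And>n. variance (X n) = \<sigma>\<^sup>2" and \<sigma>: "\<sigma> > 0"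
    and ident: "\<And>n. distr M borel (X n) = \<mu>"
  shows "AE \<omega> in M. \<not> summable (\<lambda>n. ((\<Sum>i<n. X i \<omega>) / real n)\<^sup>2)"
proof (rule ccontr)
  let ?S = "\<lambda>n \<omega>. \<Sum>i<n. X i \<omega>"
  have rv[measurable]: "random_variable borel (X n)" for n
    using indep unfolding indep_vars_def2 by simp
  assume "\<not> ?thesis"
  then have summable: "AE \<omega> in M. summable (\<lambda>n. (?S n \<omega> / real n)\<^sup>2)"
    using summable_squares_zero_one[OF indep] by blast
  obtain p where p: "p > 0"
    and big: "\<forall>\<^sub>F m in sequentially. p \<le> prob {\<omega> \<in> space M. \<sigma>\<^sup>2 * real m \<le> (?S m \<omega>)\<^sup>2}"
    by (rule clt_lower_bound[OF indep mean \<sigma> sq var ident])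
  \<comment> \<open>The value 32 / p makes the fluctuation probability 16 / K fall below p / 2. The
    choice is possible because \<open>p\<close> was fixed before \<open>K\<close>.\<close>
  obtain K :: nat where K32: "32 / p < real K" using reals_Archimedean2 by blast
  have "0 < 32 / p" using p by simp
  also note K32
  finally have K: "K > 0" by simp
  have K2: "16 / real K < p / 2"
    using K32 p K by (simp add: divide_less_eq mult.commute)
  \<comment> \<open>\<open>\<delta>\<close> is half of \<sigma>^2 / (8 K), the lower bound for block
    plus normalized fluctuation when S_m^2 >= \<sigma>^2 m. Hence one of the two must reach
    \<open>\<delta>\<close>.\<close>
  define \<delta> where "\<delta> = \<sigma>\<^sup>2 / (16 * real K)"
  have \<delta>: "\<delta> > 0" using \<sigma> K by (simp add: \<delta>_def)
  define B where "B j \<omega> = (\<Sum>n=K * j..<K * j + j. (?S n \<omega> / real n)\<^sup>2)" for j \<omega>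
  have [measurable]: "B j \<in> borel_measurable M" for j unfolding B_def by measurable
  have "AE \<omega> in M. (\<lambda>j. B j \<omega>) \<longlonglongrightarrow> 0"
    using summable
  proof eventually_elim
    fix \<omega> assume s: "summable (\<lambda>n. (?S n \<omega> / real n)\<^sup>2)"
    show "(\<lambda>j. B j \<omega>) \<longlonglongrightarrow> 0"
    proof (rule LIMSEQ_I)
      fix r :: real assume "r > 0"
      then obtain N where N: "\<And>m n. m \<ge> N \<Longrightarrow> norm (\<Sum>n=m..<n. (?S n \<omega> / real n)\<^sup>2) < r"
        using s unfolding summable_Cauchy by blast
      have "norm (B j \<omega> - 0) < r" if "j \<ge> N" for j
      proof -
        \<comment> \<open>Since K >= 1, the block starts no earlier than j, so the Cauchy criterion
          applies to all of it.\<close>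
        have "j \<le> K * j" using K by simp
        then have "N \<le> K * j" using that by linarith
        then show ?thesis using N[of "K * j" "K * j + j"] by (simp add: B_def)
      qed
      then show "\<exists>N. \<forall>j\<ge>N. norm (B j \<omega> - 0) < r" by blast
    qed
  qed
  then have "(\<lambda>j. prob {\<omega> \<in> space M. B j \<omega> \<ge> \<delta>}) \<longlonglongrightarrow> 0"
    by (intro prob_tendsto_0_if_AE_tendsto_0 \<delta>) auto
  then have small: "\<forall>\<^sub>F j in sequentially. prob {\<omega> \<in> space M. B j \<omega> \<ge> \<delta>} < p / 2"
    using p by (intro order_tendstoD) auto
  \<comment> \<open>The bound \<open>big\<close> holds for all large m; it is now restricted to the
    block starts m = K j.\<close>
  have "filterlim (\<lambda>j. K * j) at_top sequentially"
    using K by (intro filterlim_subseq) (auto simp: strict_mono_def)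
  from eventually_compose_filterlim[OF big this] small eventually_gt_at_top[of 0]
  have "\<forall>\<^sub>F j :: nat in sequentially. False"
  proof eventually_elim
    fix j :: nat
    define m where "m = K * j"
    let ?W = "\<lambda>\<omega>. \<Sum>n=m..<m + j. (?S n \<omega> - ?S m \<omega>)\<^sup>2"
    assume big: "p \<le> prob {\<omega> \<in> space M. \<sigma>\<^sup>2 * real (K * j) \<le> (?S (K * j) \<omega>)\<^sup>2}"
      and small: "prob {\<omega> \<in> space M. B j \<omega> \<ge> \<delta>} < p / 2" and j: "0 < j"
    have m: "real m > 0" using K j by (simp add: m_def)
    have c: "\<delta> * (real m)\<^sup>2 > 0" using \<delta> m by simp
    have "{\<omega> \<in> space M. \<sigma>\<^sup>2 * real m \<le> (?S m \<omega>)\<^sup>2}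
        \<subseteq> {\<omega> \<in> space M. B j \<omega> \<ge> \<delta>} \<union> {\<omega> \<in> space M. \<delta> * (real m)\<^sup>2 \<le> ?W \<omega>}"
    proof safe
      fix \<omega> assume S: "\<sigma>\<^sup>2 * real m \<le> (?S m \<omega>)\<^sup>2" and W: "\<not> \<delta> * (real m)\<^sup>2 \<le> ?W \<omega>"
      \<comment> \<open>K >= 1 gives K + 1 <= 2 K, which replaces the constant of the block
        inequality by a multiple of K^2.\<close>
      have "(real K + 1)\<^sup>2 \<le> (2 * real K)\<^sup>2" using K by (intro power_mono) auto
      then have K4: "(real K + 1)\<^sup>2 \<le> 4 * (real K)\<^sup>2" by (simp add: power_mult_distrib)
      have "2 * \<delta> = \<sigma>\<^sup>2 * real m / (2 * (4 * (real K)\<^sup>2) * real j)"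
        using K j by (simp add: \<delta>_def m_def power2_eq_square)
      also have "\<dots> \<le> (?S m \<omega>)\<^sup>2 / (2 * (real K + 1)\<^sup>2 * real j)"
        using S K4 K j by (intro frac_le mult_right_mono mult_left_mono mult_pos_pos) auto
      also have "\<dots> \<le> B j \<omega> + ?W \<omega> / (real m)\<^sup>2"
        unfolding B_def m_def using sum_squares_le_block[OF K j, of "\<lambda>n. ?S n \<omega>"] by simp
      also have "?W \<omega> / (real m)\<^sup>2 < \<delta>" using W m by (simp add: divide_less_eq)
      finally show "B j \<omega> \<ge> \<delta>" by simp
    qed
    then have "prob {\<omega> \<in> space M. \<sigma>\<^sup>2 * real m \<le> (?S m \<omega>)\<^sup>2}
        \<le> prob ({\<omega> \<in> space M. B j \<omega> \<ge> \<delta>} \<union> {\<omega> \<in> space M. \<delta> * (real m)\<^sup>2 \<le> ?W \<omega>})"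
      by (rule finite_measure_mono) measurable
    also have "\<dots> \<le> prob {\<omega> \<in> space M. B j \<omega> \<ge> \<delta>} + prob {\<omega> \<in> space M. \<delta> * (real m)\<^sup>2 \<le> ?W \<omega>}"
      by (rule measure_Un_le) measurable
    also have "prob {\<omega> \<in> space M. \<delta> * (real m)\<^sup>2 \<le> ?W \<omega>} \<le> (real j)\<^sup>2 * \<sigma>\<^sup>2 / (\<delta> * (real m)\<^sup>2)"
      by (rule prob_block_fluctuation[OF indep int mean sq var c])
    also have "\<dots> = 16 / real K"
      using \<sigma> K j by (simp add: \<delta>_def m_def power2_eq_square)
    \<comment> \<open>The chain reads p <= prob(block >= \<open>\<delta>\<close>) + 16 / K < p / 2 +
      p / 2.\<close>
    finally show False using K2 small big unfolding m_def by linarith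
  qed
  then show False by simp
qed

end

section \<open>Transfer to the sequence indexed from 1\<close>

theorem corollary2p3:
  fixes M :: "'a measure" and Y :: "nat \<Rightarrow> 'a \<Rightarrow> real" and \<sigma> :: real
  assumes "prob_space M"
    and indep: "prob_space.indep_vars M (\<lambda>_. borel) Y {1..}"
    and ident: "\<And>i. i \<ge> 1 \<Longrightarrow> distr M borel (Y i) = distr M borel (Y 1)"
    and int: "\<And>i. i \<ge> 1 \<Longrightarrow> integrable M (Y i)"
    and mean: "\<And>i. i \<ge> 1 \<Longrightarrow> prob_space.expectation M (Y i) = 0"
    and int_sq: "\<And>i. i \<ge> 1 \<Longrightarrow> integrable M (\<lambda>\<omega>. (Y i \<omega>)\<^sup>2)"
    and var: "\<And>i. i \<ge> 1 \<Longrightarrow> prob_space.variance M (Y i) = \<sigma>\<^sup>2"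
    and pos: "\<sigma>\<^sup>2 > 0"
  shows "AE \<omega> in M. (\<Sum>n. ennreal ((\<Sum>k=1..Suc n. Y k \<omega>)\<^sup>2 / (real (Suc n))\<^sup>2)) = \<infinity>"
proof -
  interpret prob_space M by fact
  have "range Suc = {1..}" by (auto simp: image_iff Suc_le_eq gr0_conv_Suc)
  then have "indep_vars (\<lambda>_. borel) (\<lambda>i. Y (Suc i)) UNIV"
    using indep_vars_reindex[of "\<lambda>_. borel" Y Suc UNIV] indep by (simp add: comp_def)
  then have "AE \<omega> in M. \<not> summable (\<lambda>n. ((\<Sum>i<n. Y (Suc i) \<omega>) / real n)\<^sup>2)"
  proof (rule AE_not_summable_squares)
    \<comment> \<open>Only the square of \<sigma> is known to be positive, so its absolute value
      serves as the standard deviation.\<close>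
    show "\<bar>\<sigma>\<bar> > 0" using pos by simp
    show "variance (Y (Suc n)) = \<bar>\<sigma>\<bar>\<^sup>2" for n using var[of "Suc n"] by simp
    show "distr M borel (Y (Suc n)) = distr M borel (Y 1)" for n by (rule ident) simp
  qed (simp_all add: int mean int_sq)
  then show ?thesis
  proof eventually_elim
    fix \<omega>
    let ?a = "\<lambda>n. ((\<Sum>i<n. Y (Suc i) \<omega>) / real n)\<^sup>2"
    assume "\<not> summable ?a"
    \<comment> \<open>Dropping the term n = 0, which is 0 by the convention for division by zero,
      aligns the series with the one starting at n = 1.\<close>
    then have "\<not> summable (\<lambda>n. ?a (Suc n))" by (subst summable_Suc_iff)
    then have "(\<Sum>n. ennreal (?a (Suc n))) = \<infinity>"
      \<comment> \<open>For nonnegative terms, failure of summability means that the sum in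
        \<open>ennreal\<close> is infinite.\<close>
      unfolding infinity_ennreal_def by (intro summable_iff_suminf_neq_top) (rule zero_le_power2)
    moreover have "?a (Suc n) = (\<Sum>k=1..Suc n. Y k \<omega>)\<^sup>2 / (real (Suc n))\<^sup>2" for n
      by (simp only: power_divide One_nat_def sum.atLeast1_atMost_eq)
    ultimately show "(\<Sum>n. ennreal ((\<Sum>k=1..Suc n. Y k \<omega>)\<^sup>2 / (real (Suc n))\<^sup>2)) = \<infinity>"
      by (simp only:)
  qed
qed

end
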